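(* (1) The parameters $(q,c)$ with $c=q(q-1)/2$ are feasible for all integers $q\ge 2$. (2) For each fixed integer $b\ge 3$, there are only finitely many positive integers $q$ such that $c=q(q-1)/b$ is an integer and $(q,c)$ is feasible.
   Context: A pair $(q,c)$ of positive integers is called feasible (as parameters for a strongly regular graph with no triangles) if $1\le c\le q(q+1)$ and the following two conditions hold: (i) $c$ divides $q^4-q^2$; (ii) $c+2q$ divides the integer $q^4+3q^3+5q^2+3q+q\,(q^4-q^2)/c$. *)

theory Defs
  imports Main
begin

text \<open>
  The quotient in the last conjunct is exact because of the divisibility condition preceding it.
\<close>

definition feasible :: "int \<Rightarrow> int \<Rightarrow> bool" where
  "feasible q c \<longleftrightarrow>
     q > 0 \<and> 1 \<le> c \<and> c \<le> q * (q + 1) \<and>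
     c dvd q ^ 4 - q ^ 2 \<and>
     c + 2 * q dvd q ^ 4 + 3 * q ^ 3 + 5 * q ^ 2 + 3 * q + q * ((q ^ 4 - q ^ 2) div c)"

end

theory Submission
  imports Defs
begin

text \<open>
  Write \<open>c = q (q - 1) / b\<close>, so that \<open>(q\<^sup>4 - q\<^sup>2) / c = b q (q + 1)\<close> and
  \<open>c + 2 q = q (q - 1 + 2 b) / b\<close>. After cancelling \<open>q\<close>, feasibility forces the linear
  polynomial \<open>q - 1 + 2 b\<close> to divide \<open>b\<close> times the cubic
  \<open>q\<^sup>3 + 3 q\<^sup>2 + 5 q + 3 + b q (q + 1)\<close>. Reducing the cubic modulo the linear factor,
  that is, evaluating it at \<open>q = 1 - 2 b\<close>, leaves the remainder
  \<open>(2 - 2 b) (2 b - 3) (b - 2)\<close>.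

  For \<open>b = 2\<close> the remainder vanishes; indeed the cubic is then
  \<open>(q + 1)\<^sup>2 (q + 3)\<close> and divisibility holds identically in \<open>q\<close>. For \<open>b \<ge> 3\<close> the
  remainder is a nonzero constant, and only finitely many \<open>q\<close> can satisfy
  \<open>q - 1 + 2 b\<close> dividing a fixed nonzero integer.
\<close>

lemma quartic_div:
  fixes q b c :: int
  assumes "b * c = q * (q - 1)" and "c \<noteq> 0"
  shows "c dvd q ^ 4 - q ^ 2" and "(q ^ 4 - q ^ 2) div c = b * q * (q + 1)"
proof -
  have "q ^ 4 - q ^ 2 = (q * (q - 1)) * (q * (q + 1))"
    by (simp add: algebra_simps power2_eq_square power4_eq_xxxx)
  also have "\<dots> = c * (b * q * (q + 1))"
    by (simp only: assms(1)[symmetric] ac_simps)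
  finally have *: "q ^ 4 - q ^ 2 = c * (b * q * (q + 1))" .
  show "c dvd q ^ 4 - q ^ 2"
    unfolding * by simp
  show "(q ^ 4 - q ^ 2) div c = b * q * (q + 1)"
    unfolding * using assms(2) by simp
qed

lemma feasible_half:
  fixes q :: int
  assumes "q \<ge> 2"
  shows "feasible q (q * (q - 1) div 2)"
proof -
  define c where "c = q * (q - 1) div 2"
  have c: "2 * c = q * (q - 1)"
    unfolding c_def by simp
  have "0 < q * (q - 1)"
    using assms by simp
  with c have pos: "1 \<le> c"
    by linarith
  have "q * (q - 1) \<le> q * (q + 1)"
    using assms by (intro mult_left_mono) auto
  with c pos have le: "c \<le> q * (q + 1)"
    by linarith
  have "q ^ 4 + 3 * q ^ 3 + 5 * q ^ 2 + 3 * q + q * (2 * q * (q + 1))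
      = (q * (q - 1) + 4 * q) * (q + 1) ^ 2"
    by algebra
  also have "\<dots> = (c + 2 * q) * (2 * (q + 1) ^ 2)"
    unfolding c[symmetric] by (simp add: algebra_simps)
  finally have "c + 2 * q dvd q ^ 4 + 3 * q ^ 3 + 5 * q ^ 2 + 3 * q + q * (2 * q * (q + 1))"
    by simp
  then have "feasible q c"
    unfolding feasible_def using assms pos le quartic_div[OF c] by simp
  then show ?thesis
    unfolding c_def .
qed

text \<open>
  The right-hand side is the remainder computed above: it does not depend on \<open>q\<close>, which is
  what bounds \<open>q\<close> in terms of \<open>b\<close>.
\<close>

lemma feasible_imp_linear_dvd:
  fixes q b c :: int
  assumes "feasible q c" and c: "b * c = q * (q - 1)"
  shows "q - 1 + 2 * b dvd b * ((2 - 2 * b) * ((2 * b - 3) * (b - 2)))"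
proof -
  define M where "M = q ^ 3 + 3 * q ^ 2 + 5 * q + 3 + b * q * (q + 1)"
  have q: "q > 0" and c0: "c \<noteq> 0"
    using assms(1) by (auto simp: feasible_def)
  have "c + 2 * q dvd q ^ 4 + 3 * q ^ 3 + 5 * q ^ 2 + 3 * q + q * (b * q * (q + 1))"
    using assms(1) quartic_div(2)[OF c c0] by (simp add: feasible_def)
  also have "q ^ 4 + 3 * q ^ 3 + 5 * q ^ 2 + 3 * q + q * (b * q * (q + 1)) = q * M"
    unfolding M_def by algebra
  finally have "b * (c + 2 * q) dvd b * (q * M)"
    by (rule mult_dvd_mono[OF dvd_refl])
  moreover have "b * (c + 2 * q) = q * (q - 1 + 2 * b)"
    using c by (simp add: algebra_simps)
  ultimately have "q * (q - 1 + 2 * b) dvd q * (b * M)"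
    by (metis mult.left_commute)
  then have dvd: "q - 1 + 2 * b dvd b * M"
    using q by simp
  \<comment> \<open>The quadratic factor is the quotient of the cubic by \<open>q - (1 - 2 b)\<close> (Horner's scheme).\<close>
  have "b * ((2 - 2 * b) * ((2 * b - 3) * (b - 2)))
      = b * M - (q - 1 + 2 * b) * (b * (q ^ 2 + (4 - b) * q + ((1 - 2 * b) * (4 - b) + 5 + b)))"
    unfolding M_def by algebra
  with dvd show ?thesis
    by simp
qed

lemma finite_feasible_quotient:
  fixes b :: int
  assumes "b \<ge> 3"
  shows "finite {q::int. q > 0 \<and> b dvd q * (q - 1) \<and> feasible q (q * (q - 1) div b)}"
proof -
  define K where "K = b * ((2 - 2 * b) * ((2 * b - 3) * (b - 2)))"
  have "K \<noteq> 0"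
    using assms unfolding K_def by simp
  have "q \<le> \<bar>K\<bar>" if "b dvd q * (q - 1)" "feasible q (q * (q - 1) div b)" for q
  proof -
    have "q - 1 + 2 * b dvd K"
      unfolding K_def using that by (intro feasible_imp_linear_dvd) auto
    then have "\<bar>q - 1 + 2 * b\<bar> \<le> \<bar>K\<bar>"
      using \<open>K \<noteq> 0\<close> by (simp add: dvd_imp_le_int)
    with assms show ?thesis
      by linarith
  qed
  then have "{q::int. q > 0 \<and> b dvd q * (q - 1) \<and> feasible q (q * (q - 1) div b)} \<subseteq> {0..\<bar>K\<bar>}"
    by auto
  then show ?thesis
    by (rule finite_subset) simp
qed

theorem mainTheorem5:
  shows "(\<forall>q::int. q \<ge> 2 \<longrightarrow> feasible q (q * (q - 1) div 2)) \<and>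
         (\<forall>b::int. b \<ge> 3 \<longrightarrow>
            finite {q::int. q > 0 \<and> b dvd q * (q - 1) \<and> feasible q (q * (q - 1) div b)})"
  using feasible_half finite_feasible_quotient by blast

end
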